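(* Let $\widetilde\nabla$ be a special second-order symmetric connection on $T^{(2)}M$ and let $K$ be the unique symmetric third-order Hessian structure on $M$ associated to $\widetilde\nabla$. Then for all $f\in\mathcal F(M)$, all $m\in M$ and all $v\in T_mM$, $$Kf(m)(v,v,v)=(f\circ c)'''(0)$$ whenever there is a second-order geodesic $c$ of $\widetilde\nabla$ with $c(0)=m$ and $\dot c(0)=v$.
   Context: $M$ is a Hausdorff, paracompact, smooth manifold modelled on a finite-dimensional Banach space $\mathbf E$; $\mathcal F(M)$ is the space of smooth real functions on $M$. For a chart $(U,\varphi)$: $f_\varphi=f\circ\varphi^{-1}$, $X_\varphi:\varphi U\to\mathbf E$ is the local representative of a vector field $X$, and $c_\varphi=\varphi\circ c$ for a curve $c$. Second-order tangent bundle. $\mathbf E\Delta\mathbf E$ is the symmetric tensor product of $\mathbf E$ with itself, with product $y\Delta z=z\Delta y$; symmetric bilinear maps on $\mathbf E\times\mathbf E$ are identified with linear maps on $\mathbf E\Delta\mathbf E$, so $D^2F(u)\cdot(y\Delta z)=D^2F(u)(y,z)$; for linear $A$, $(A\Delta A)(y\Delta z)=Ay\Delta Az$. $T^{(2)}M$ is the vector bundle over $M$ with fibre $\mathbf E\oplus(\mathbf E\Delta\mathbf E)$ whose local representatives $e\oplus s$ in a chart $\varphi$ and $\bar e\oplus\bar s$ in a chart $\psi$ of the same element over $m$ are related, with $F=\psi\circ\varphi^{-1}$ and $u=\varphi m$, by $\bar e=DF(u)\cdot e+D^2F(u)\cdot s$ and $\bar s=(DF(u)\Delta DF(u))\cdot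 s$. Connections. A connection $\widetilde\nabla$ on $T^{(2)}M$ is a Koszul connection on this vector bundle; in a chart $(\widetilde\nabla_X\tau)_\varphi=D\tau_\varphi\cdot X_\varphi-\widetilde\Gamma_\varphi(X_\varphi,\tau_\varphi)$. It is a special second-order connection if in every chart $\widetilde\Gamma_\varphi(X_\varphi,V_\varphi\oplus S_\varphi)=R_\varphi(X_\varphi,S_\varphi)\oplus(-X_\varphi\Delta V_\varphi+C_\varphi(X_\varphi,S_\varphi))$ with $R_\varphi$ valued in $\mathbf E$, $C_\varphi$ valued in $\mathbf E\Delta\mathbf E$, both bilinear and smooth in the base point (the Christoffel symbols of $\widetilde\nabla$). One writes $R_\varphi(X,Y,Z)=R_\varphi(X,Y\Delta Z)$, $C_\varphi(X,Y,Z)=C_\varphi(X,Y\Delta Z)$. Associated Hessian structure. The third-order Hessian structure $K$ associated to $\widetilde\nabla$ assigns to each $f$ the covariant tensor field of order $3$ given in every chart by $Kf(X,Y,Z)=D^3f_\varphi(X_\varphi,Y_\varphi,Z_\varphi)+D^2f_\varphi\cdot C_\varphi(X_\varphi,Y_\varphi,Z_\varphi)+Df_\varphi\cdot R_\varphi(X_\varphi,Y_\varphi,Z_\varphi)$ (this is well-defined independently of charts). $\widetilde\nabla$ is called symmetric if $K$ is symmetric, i.e. $Kf$ is a symmetric tensor for all $f$. Second-order geodesics. For a smooth curve $c$ in $M$, $\ddot c$ is the section of $T^{(2)}M$ along $c$ with local representative $c_\varphi''\oplus(c_\varphi'\Delta c_\varphi')$. $c$ is a second-order geodesic of $\widetilde\nabla$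 if $\widetilde\nabla_{\dot c}\ddot c=0$ for all $t$; equivalently, in every chart, $c_\varphi'''=R_\varphi(c_\varphi',c_\varphi',c_\varphi')$ and $C_\varphi(c_\varphi',c_\varphi',c_\varphi')=3\,c_\varphi'\Delta c_\varphi''$. *)

theory Defs
  imports "HOL-Analysis.Analysis"
begin

section \<open>The symmetric tensor product\<close>

text \<open>
  For a finite-dimensional normed space \<open>E\<close>, the symmetric tensor square is realised as the dual of
  the space of symmetric bilinear forms on \<open>E\<close>, with the product of \<open>y\<close> and \<open>z\<close> being
  evaluation at \<open>(y, z)\<close>. The universal property is \<open>sym_prod_universal\<close> below.
\<close>

typedef (overloaded) 'a sym_form =
  "{B :: 'a::real_normed_vector \<Rightarrow>\<^sub>L 'a \<Rightarrow>\<^sub>L real. \<forall>y z. B y z = B z y}"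
  by (rule exI[of _ 0]) simp

setup_lifting type_definition_sym_form

instantiation sym_form :: (real_normed_vector) real_normed_vector
begin

lift_definition zero_sym_form :: "'a sym_form" is 0 by simp
lift_definition plus_sym_form :: "'a sym_form \<Rightarrow> 'a sym_form \<Rightarrow> 'a sym_form" is "(+)"
  by (simp add: blinfun.add_left)
lift_definition minus_sym_form :: "'a sym_form \<Rightarrow> 'a sym_form \<Rightarrow> 'a sym_form" is "(-)"
  by (simp add: blinfun.diff_left)
lift_definition uminus_sym_form :: "'a sym_form \<Rightarrow> 'a sym_form" is uminus
  by (simp add: blinfun.minus_left)
lift_definition scaleR_sym_form :: "real \<Rightarrow> 'a sym_form \<Rightarrow> 'a sym_form" is scaleR
  by (simp add: blinfun.scaleR_left)
lift_definition norm_sym_form :: "'a sym_form \<Rightarrow> real" is norm .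

definition dist_sym_form :: "'a sym_form \<Rightarrow> 'a sym_form \<Rightarrow> real"
  where "dist_sym_form a b = norm (a - b)"
definition sgn_sym_form :: "'a sym_form \<Rightarrow> 'a sym_form"
  where "sgn_sym_form a = inverse (norm a) *\<^sub>R a"
definition uniformity_sym_form :: "('a sym_form \<times> 'a sym_form) filter"
  where "uniformity_sym_form = (INF e\<in>{0<..}. principal {(x, y). dist x y < e})"
definition open_sym_form :: "'a sym_form set \<Rightarrow> bool"
  where "open_sym_form S \<longleftrightarrow> (\<forall>x\<in>S. \<forall>\<^sub>F (x', y) in uniformity. x' = x \<longrightarrow> y \<in> S)"

instance
proof
  fix a b c :: "'a sym_form" and r s :: real
  show "a + b + c = a + (b + c)" by transfer simp
  show "a + b = b + a" by transfer simp
  show "0 + a = a" by transfer simp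
  show "- a + a = 0" by transfer simp
  show "a - b = a + - b" by transfer simp
  show "r *\<^sub>R (a + b) = r *\<^sub>R a + r *\<^sub>R b" by transfer (simp add: scaleR_add_right)
  show "(r + s) *\<^sub>R a = r *\<^sub>R a + s *\<^sub>R a" by transfer (simp add: scaleR_add_left)
  show "r *\<^sub>R s *\<^sub>R a = (r * s) *\<^sub>R a" by transfer simp
  show "1 *\<^sub>R a = a" by transfer simp
  show "norm a = 0 \<longleftrightarrow> a = 0" by transfer simp
  show "norm (a + b) \<le> norm a + norm b" by transfer (rule norm_triangle_ineq)
  show "norm (r *\<^sub>R a) = \<bar>r\<bar> * norm a" by transfer simp
qed (simp_all only: dist_sym_form_def sgn_sym_form_def uniformity_sym_form_def open_sym_form_def)

end

type_synonym 'a sym2 = "'a sym_form \<Rightarrow>\<^sub>L real"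

lift_definition sym_prod :: "'a::real_normed_vector \<Rightarrow> 'a \<Rightarrow> 'a sym2"  (infixl \<open>\<Delta>\<close> 70)
  is "\<lambda>y z B. Rep_sym_form B y z"
proof -
  fix y z :: 'a
  show "bounded_linear (\<lambda>B. Rep_sym_form B y z)"
  proof (rule bounded_linear_intro)
    fix B C :: "'a sym_form" and r :: real
    show "Rep_sym_form (B + C) y z = Rep_sym_form B y z + Rep_sym_form C y z"
      by (simp add: plus_sym_form.rep_eq blinfun.add_left)
    show "Rep_sym_form (r *\<^sub>R B) y z = r *\<^sub>R Rep_sym_form B y z"
      by (simp add: scaleR_sym_form.rep_eq blinfun.scaleR_left)
    have "norm (Rep_sym_form B y z) \<le> norm (Rep_sym_form B y) * norm z"
      by (rule norm_blinfun)
    also have "\<dots> \<le> (norm (Rep_sym_form B) * norm y) * norm z"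
      by (intro mult_right_mono norm_blinfun) simp
    finally show "norm (Rep_sym_form B y z) \<le> norm B * (norm y * norm z)"
      by (simp add: norm_sym_form.rep_eq mult.assoc)
  qed
qed

text \<open>The linear map on the symmetric tensor square identified with a symmetric bilinear map.\<close>

definition sym_lin :: "('a::real_normed_vector \<Rightarrow> 'a \<Rightarrow> 'b::real_vector) \<Rightarrow> 'a sym2 \<Rightarrow> 'b"
  where "sym_lin B = (THE L. linear L \<and> (\<forall>y z. L (y \<Delta> z) = B y z))"

lemma sym_prod_commute: "y \<Delta> z = z \<Delta> y"
  by (rule blinfun_eqI) (use Rep_sym_form in \<open>auto simp: sym_prod.rep_eq\<close>)

lemma bilinear_sym_prod: "bilinear (\<Delta>)"
  unfolding bilinear_def
  by (auto intro!: linearI blinfun_eqI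
      simp: sym_prod.rep_eq blinfun.add_left blinfun.add_right blinfun.scaleR_left blinfun.scaleR_right)

lemma infdist_subspace_bound:
  fixes S :: "'a::real_normed_vector set"
  assumes S: "subspace S" and y: "y \<in> S"
  shows "\<bar>r\<bar> * infdist a S \<le> norm (r *\<^sub>R a + y)"
proof (cases "r = 0")
  case False
  have "- (1 / r) *\<^sub>R y \<in> S" using S y subspace_scale by blast
  then have "infdist a S \<le> dist a (- (1 / r) *\<^sub>R y)" by (rule infdist_le)
  also have "\<dots> = norm (a + (1 / r) *\<^sub>R y)" by (simp add: dist_norm)
  also have "a + (1 / r) *\<^sub>R y = (1 / r) *\<^sub>R (r *\<^sub>R a + y)"
    using False by (simp add: scaleR_add_right)
  also have "norm \<dots> = norm (r *\<^sub>R a + y) / \<bar>r\<bar>" by simp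
  finally show ?thesis using False by (simp add: field_simps)
qed simp

lemma complete_span_finite:
  fixes B :: "'a::real_normed_vector set"
  assumes "finite B"
  shows "complete (span B)"
  using assms
proof induction
  case empty
  show ?case by (simp add: finite_imp_compact compact_imp_complete)
next
  case (insert a B)
  show ?case
  proof (cases "a \<in> span B")
    case True
    then show ?thesis using insert.IH by (simp add: span_redundant)
  next
    case False
    define d where "d = infdist a (span B)"
    have cl: "closed (span B)" using insert.IH by (rule complete_imp_closed)
    have ne: "span B \<noteq> {}" using span_zero by blast
    have d: "d > 0"
      unfolding d_def using False cl ne in_closed_iff_infdist_zero[OF cl ne, of a]
      by (simp add: less_le infdist_nonneg)
    show ?thesis
      unfolding complete_def
    proof (intro allI impI, elim conjE)
      fix x :: "nat \<Rightarrow> 'a"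
      assume xin: "\<forall>n. x n \<in> span (insert a B)" and cx: "Cauchy x"
      have "\<forall>n. \<exists>k. x n - k *\<^sub>R a \<in> span B" using xin by (simp add: span_insert)
      then obtain k where k: "\<And>n. x n - k n *\<^sub>R a \<in> span B" by metis
      have le: "\<bar>k m - k n\<bar> * d \<le> dist (x m) (x n)" for m n
      proof -
        have "(x m - k m *\<^sub>R a) - (x n - k n *\<^sub>R a) \<in> span B" using k span_diff by blast
        from infdist_subspace_bound[OF subspace_span this, of "k m - k n" a]
        show ?thesis by (simp add: d_def dist_norm algebra_simps)
      qed
      have "Cauchy k"
      proof (rule metric_CauchyI)
        fix e :: real assume "e > 0"
        then have "e * d > 0" using d by simp
        then obtain N where N: "\<forall>m\<ge>N. \<forall>n\<ge>N. dist (x m) (x n) < e * d"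
          using cx metric_CauchyD by blast
        have "dist (k m) (k n) < e" if "m \<ge> N" "n \<ge> N" for m n
        proof -
          have "\<bar>k m - k n\<bar> * d < e * d" using le[of m n] N that by fastforce
          then show ?thesis using d by (simp add: dist_real_def)
        qed
        then show "\<exists>M. \<forall>m\<ge>M. \<forall>n\<ge>M. dist (k m) (k n) < e" by blast
      qed
      then obtain l where l: "k \<longlonglongrightarrow> l"
        using Cauchy_convergent convergent_def by blast
      have c1: "Cauchy (\<lambda>n. k n *\<^sub>R a)"
        using l by (intro LIMSEQ_imp_Cauchy) (auto intro: tendsto_intros)
      have "Cauchy (\<lambda>n. x n - k n *\<^sub>R a)"
      proof (rule metric_CauchyI)
        fix e :: real assume "e > 0"
        then have "e / 2 > 0" by simp
        then obtain N1 N2 where N: "\<forall>m\<ge>N1. \<forall>n\<ge>N1. dist (x m) (x n) < e / 2"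
            "\<forall>m\<ge>N2. \<forall>n\<ge>N2. dist (k m *\<^sub>R a) (k n *\<^sub>R a) < e / 2"
          using metric_CauchyD[OF cx] metric_CauchyD[OF c1] by meson
        have "dist (x m - k m *\<^sub>R a) (x n - k n *\<^sub>R a) < e" if "m \<ge> max N1 N2" "n \<ge> max N1 N2" for m n
        proof -
          have "dist (x m - k m *\<^sub>R a) (x n - k n *\<^sub>R a)
              \<le> dist (x m) (x n) + dist (k m *\<^sub>R a) (k n *\<^sub>R a)"
            using norm_triangle_ineq4[of "x m - x n" "k m *\<^sub>R a - k n *\<^sub>R a"]
            by (simp add: dist_norm algebra_simps)
          moreover have "dist (x m) (x n) < e / 2" "dist (k m *\<^sub>R a) (k n *\<^sub>R a) < e / 2"
            using N that by auto
          ultimately show ?thesis by linarith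
        qed
        then show "\<exists>M. \<forall>m\<ge>M. \<forall>n\<ge>M. dist (x m - k m *\<^sub>R a) (x n - k n *\<^sub>R a) < e" by blast
      qed
      then obtain y where y: "y \<in> span B" "(\<lambda>n. x n - k n *\<^sub>R a) \<longlonglongrightarrow> y"
        using insert.IH[unfolded complete_def, rule_format, of "\<lambda>n. x n - k n *\<^sub>R a"] k by auto
      have "(\<lambda>n. (x n - k n *\<^sub>R a) + k n *\<^sub>R a) \<longlonglongrightarrow> y + l *\<^sub>R a"
        using y l by (intro tendsto_intros)
      then have "x \<longlonglongrightarrow> y + l *\<^sub>R a" by simp
      moreover have "y + l *\<^sub>R a \<in> span (insert a B)"
        using y by (auto simp: span_insert intro!: exI[of _ l])
      ultimately show "\<exists>l\<in>span (insert a B). x \<longlonglongrightarrow> l" by blast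
    qed
  qed
qed

lemma bounded_linear_finite_dim:
  fixes f :: "'a::real_normed_vector \<Rightarrow> real"
  assumes B: "finite B" "span B = (UNIV :: 'a set)" and f: "linear f"
  shows "bounded_linear f"
proof (cases "\<forall>x. f x = 0")
  case True
  then have "f = (\<lambda>_. 0)" by auto
  then show ?thesis by simp
next
  case False
  then obtain b where "f b \<noteq> 0" by blast
  define a where "a = (1 / f b) *\<^sub>R b"
  have fa: "f a = 1" using \<open>f b \<noteq> 0\<close> by (simp add: a_def linear_cmul[OF f])
  define K where "K = {x. f x = 0}"
  have sK: "subspace K" unfolding K_def using f by (rule linear_subspace_kernel)
  obtain C where C: "C \<subseteq> K" "independent C" "span C = K"
    using basis_exists[of K] sK by (metis span_subspace)
  have "finite C" using independent_span_bound[OF B(1) C(2)] B(2) by auto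
  then have "closed K" using complete_span_finite[of C] C(3) complete_imp_closed by metis
  moreover have "a \<notin> K" using fa by (simp add: K_def)
  moreover have "K \<noteq> {}" using sK subspace_0 by blast
  ultimately have d: "infdist a K > 0"
    using in_closed_iff_infdist_zero[of K a] by (simp add: less_le infdist_nonneg)
  show ?thesis
  proof (rule bounded_linear_intro)
    show "f (x + y) = f x + f y" for x y using f by (rule linear_add)
    show "f (r *\<^sub>R x) = r *\<^sub>R f x" for r x using f by (rule linear_cmul)
    fix x
    have "x - f x *\<^sub>R a \<in> K"
      by (simp add: K_def linear_diff[OF f] linear_cmul[OF f] fa)
    from infdist_subspace_bound[OF sK this, of "f x" a]
    show "norm (f x) \<le> norm x * (1 / infdist a K)"
      using d by (simp add: field_simps)
  qed
qed

lemma sym_prod_universal: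
  fixes \<beta> :: "'a::real_normed_vector \<Rightarrow> 'a \<Rightarrow> 'b::real_vector"
  assumes fin: "finite B" "span B = (UNIV :: 'a set)"
    and \<beta>: "bilinear \<beta>" "\<And>y z. \<beta> y z = \<beta> z y"
  shows "\<exists>!L. linear L \<and> (\<forall>y z. L (y \<Delta> z) = \<beta> y z)"
proof -
  obtain C where C: "independent C" "span C = (UNIV :: 'a set)"
    using basis_exists[of "UNIV :: 'a set"] by (metis top.extremum_uniqueI)
  have finC: "finite C" using independent_span_bound[OF fin(1) C(1)] fin(2) by auto
  define e where "e b x = representation C x b" for b x
  have le: "linear (e b)" for b
    unfolding e_def
    by (rule linearI) (simp_all add: C representation_add representation_scale)
  have bl: "bounded_linear (e b)" for b
    using bounded_linear_finite_dim[OF fin le] .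
  have ex: "(\<Sum>b\<in>C. e b x *\<^sub>R b) = x" for x
    unfolding e_def by (rule sum_representation_eq[OF C(1) _ finC]) (auto simp: C)
  have "\<forall>b b'. \<exists>B. \<forall>y z. Rep_sym_form B y z = (e b y * e b' z + e b z * e b' y) / 2"
  proof (intro allI)
    fix b b'
    define g h where "g = Blinfun (e b)" and "h = Blinfun (e b')"
    have [simp]: "blinfun_apply g = e b" "blinfun_apply h = e b'"
      by (simp_all add: g_def h_def bounded_linear_Blinfun_apply bl)
    define A where "A y = (1/2) *\<^sub>R (e b y *\<^sub>R h + e b' y *\<^sub>R g)" for y
    have "bounded_linear A"
      unfolding A_def
      by (intro bounded_linear_const_scaleR bounded_linear_add bounded_linear_scaleR_const bl)
    then have app: "blinfun_apply (Blinfun A) = A" by (rule bounded_linear_Blinfun_apply)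
    have "Blinfun A \<in> {B. \<forall>y z. blinfun_apply (blinfun_apply B y) z = blinfun_apply (blinfun_apply B z) y}"
      by (simp add: app) (simp add: A_def blinfun.scaleR_left blinfun.add_left algebra_simps)
    then have "Rep_sym_form (Abs_sym_form (Blinfun A)) = Blinfun A"
      by (rule Abs_sym_form_inverse)
    then show "\<exists>B. \<forall>y z. Rep_sym_form B y z = (e b y * e b' z + e b z * e b' y) / 2"
      by (intro exI[of _ "Abs_sym_form (Blinfun A)"])
         (simp add: app, simp add: A_def blinfun.scaleR_left blinfun.add_left algebra_simps add_divide_distrib)
  qed
  then obtain E where E: "\<And>b b' y z. Rep_sym_form (E b b') y z = (e b y * e b' z + e b z * e b' y) / 2"
    by metis
  have expand: "\<gamma> y z = (\<Sum>b\<in>C. \<Sum>b'\<in>C. (e b y * e b' z) *\<^sub>R \<gamma> b b')"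
    if "bilinear \<gamma>" for \<gamma> :: "'a \<Rightarrow> 'a \<Rightarrow> 'c::real_vector" and y z
  proof -
    have "\<gamma> y z = \<gamma> (\<Sum>b\<in>C. e b y *\<^sub>R b) (\<Sum>b'\<in>C. e b' z *\<^sub>R b')" by (simp add: ex)
    also have "\<dots> = (\<Sum>b\<in>C. \<Sum>b'\<in>C. \<gamma> (e b y *\<^sub>R b) (e b' z *\<^sub>R b'))"
      by (simp add: bilinear_sum[OF that] sum.cartesian_product)
    also have "\<dots> = (\<Sum>b\<in>C. \<Sum>b'\<in>C. (e b y * e b' z) *\<^sub>R \<gamma> b b')"
      by (simp add: bilinear_lmul[OF that] bilinear_rmul[OF that] mult.commute)
    finally show ?thesis .
  qed
  have symexp: "(\<Sum>b\<in>C. \<Sum>b'\<in>C. ((e b y * e b' z + e b z * e b' y) / 2) *\<^sub>R \<gamma> b b') = \<gamma> y z"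
    if "bilinear \<gamma>" "\<And>y z. \<gamma> y z = \<gamma> z y" for \<gamma> :: "'a \<Rightarrow> 'a \<Rightarrow> 'c::real_vector" and y z
  proof -
    have "(\<Sum>b\<in>C. \<Sum>b'\<in>C. ((e b y * e b' z + e b z * e b' y) / 2) *\<^sub>R \<gamma> b b')
        = (1/2) *\<^sub>R ((\<Sum>b\<in>C. \<Sum>b'\<in>C. (e b y * e b' z) *\<^sub>R \<gamma> b b')
                 + (\<Sum>b\<in>C. \<Sum>b'\<in>C. (e b z * e b' y) *\<^sub>R \<gamma> b b'))"
      by (simp add: sum.distrib[symmetric] scaleR_sum_right scaleR_add_left[symmetric])
    also have "\<dots> = (1/2) *\<^sub>R (\<gamma> y z + \<gamma> z y)"
      using expand[OF that(1), of y z] expand[OF that(1), of z y] by simp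
    also have "\<dots> = \<gamma> y z" using that(2)[of z y] by (simp add: scaleR_2[symmetric])
    finally show ?thesis .
  qed
  have span: "s = (\<Sum>b\<in>C. \<Sum>b'\<in>C. s (E b b') *\<^sub>R (b \<Delta> b'))" for s :: "'a sym2"
  proof (rule blinfun_eqI)
    fix F :: "'a sym_form"
    have bF: "bilinear (\<lambda>y z. Rep_sym_form F y z)"
      unfolding bilinear_def
      by (auto intro!: linearI simp: blinfun.add_left blinfun.add_right
          blinfun.scaleR_left blinfun.scaleR_right)
    have sF: "Rep_sym_form F y z = Rep_sym_form F z y" for y z
      using Rep_sym_form[of F] by auto
    have rep_sum: "Rep_sym_form (sum G A) y z = (\<Sum>i\<in>A. Rep_sym_form (G i) y z)"
      for G :: "'a \<Rightarrow> 'a sym_form" and A y z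
      by (induction A rule: infinite_finite_induct)
         (simp_all add: zero_sym_form.rep_eq plus_sym_form.rep_eq blinfun.add_left)
    have "F = (\<Sum>b\<in>C. \<Sum>b'\<in>C. Rep_sym_form F b b' *\<^sub>R E b b')"
    proof (rule Rep_sym_form_inject[THEN iffD1], intro blinfun_eqI)
      fix y z
      show "Rep_sym_form F y z = Rep_sym_form (\<Sum>b\<in>C. \<Sum>b'\<in>C. Rep_sym_form F b b' *\<^sub>R E b b') y z"
        using symexp[OF bF sF, of y z]
        by (simp add: rep_sum scaleR_sym_form.rep_eq blinfun.scaleR_left E mult.commute)
    qed
    then have "s F = s (\<Sum>b\<in>C. \<Sum>b'\<in>C. Rep_sym_form F b b' *\<^sub>R E b b')" by simp
    also have "\<dots> = (\<Sum>b\<in>C. \<Sum>b'\<in>C. Rep_sym_form F b b' * s (E b b'))"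
      by (simp add: blinfun.sum_right blinfun.scaleR_right)
    also have "\<dots> = (\<Sum>b\<in>C. \<Sum>b'\<in>C. s (E b b') *\<^sub>R (b \<Delta> b')) F"
      by (simp add: blinfun.sum_left blinfun.scaleR_left sym_prod.rep_eq mult.commute)
    finally show "s F = (\<Sum>b\<in>C. \<Sum>b'\<in>C. s (E b b') *\<^sub>R (b \<Delta> b')) F" .
  qed
  show ?thesis
  proof (rule ex1I[where a = "\<lambda>s :: 'a sym2. \<Sum>b\<in>C. \<Sum>b'\<in>C. s (E b b') *\<^sub>R \<beta> b b'"], intro conjI allI)
    show "linear (\<lambda>s :: 'a sym2. \<Sum>b\<in>C. \<Sum>b'\<in>C. s (E b b') *\<^sub>R \<beta> b b')"
      by (rule linearI)
         (simp_all add: blinfun.add_left blinfun.scaleR_left scaleR_add_left sum.distrib scaleR_sum_right)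
    show "(\<Sum>b\<in>C. \<Sum>b'\<in>C. (y \<Delta> z) (E b b') *\<^sub>R \<beta> b b') = \<beta> y z" for y z
      using symexp[OF \<beta>, of y z] by (simp add: sym_prod.rep_eq E)
  next
    fix L :: "'a sym2 \<Rightarrow> 'b"
    assume *: "linear L \<and> (\<forall>y z. L (y \<Delta> z) = \<beta> y z)"
    then have L: "linear L" and eq: "\<And>y z. L (y \<Delta> z) = \<beta> y z" by auto
    show "L = (\<lambda>s. \<Sum>b\<in>C. \<Sum>b'\<in>C. s (E b b') *\<^sub>R \<beta> b b')"
    proof
      fix s
      have "L s = L (\<Sum>b\<in>C. \<Sum>b'\<in>C. s (E b b') *\<^sub>R (b \<Delta> b'))" using span[of s] by simp
      also have "\<dots> = (\<Sum>b\<in>C. \<Sum>b'\<in>C. s (E b b') *\<^sub>R \<beta> b b')"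
        by (simp add: linear_sum[OF L] linear_cmul[OF L] eq)
      finally show "L s = (\<Sum>b\<in>C. \<Sum>b'\<in>C. s (E b b') *\<^sub>R \<beta> b b')" .
    qed
  qed
qed

lemma sym_lin:
  assumes "finite B" "span B = (UNIV :: 'a::real_normed_vector set)"
    and "bilinear \<beta>" "\<And>y z :: 'a. \<beta> y z = \<beta> z y"
  shows "linear (sym_lin \<beta>)" "sym_lin \<beta> (y \<Delta> z) = \<beta> y z"
  using theI'[OF sym_prod_universal[OF assms]] by (auto simp: sym_lin_def)


section \<open>Differential calculus\<close>

definition D1 :: "('a::real_normed_vector \<Rightarrow> 'b::real_normed_vector) \<Rightarrow> 'a \<Rightarrow> 'a \<Rightarrow> 'b"
  where "D1 F u x = frechet_derivative F (at u) x"

definition D2 :: "('a::real_normed_vector \<Rightarrow> 'b::real_normed_vector) \<Rightarrow> 'a \<Rightarrow> 'a \<Rightarrow> 'a \<Rightarrow> 'b"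
  where "D2 F u x y = D1 (\<lambda>w. D1 F w y) u x"

definition D3 :: "('a::real_normed_vector \<Rightarrow> 'b::real_normed_vector) \<Rightarrow> 'a \<Rightarrow> 'a \<Rightarrow> 'a \<Rightarrow> 'a \<Rightarrow> 'b"
  where "D3 F u x y z = D1 (\<lambda>w. D2 F w y z) u x"

text \<open>
  \<open>Ck_on n F S\<close> is continuous differentiability of order \<open>n\<close> on an open subset \<open>S\<close> of a
  finite-dimensional space; there, continuity of the derivative as a map into linear maps amounts
  to continuity of all directional derivatives.
\<close>

primrec Ck_on :: "nat \<Rightarrow> ('a::real_normed_vector \<Rightarrow> 'b::real_normed_vector) \<Rightarrow> 'a set \<Rightarrow> bool" where
  "Ck_on 0 F S \<longleftrightarrow> continuous_on S F"
| "Ck_on (Suc n) F S \<longleftrightarrow>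
     (\<forall>u\<in>S. F differentiable (at u)) \<and> (\<forall>x. Ck_on n (\<lambda>u. D1 F u x) S)"

definition smooth_on :: "'a::real_normed_vector set \<Rightarrow> ('a \<Rightarrow> 'b::real_normed_vector) \<Rightarrow> bool"
  where "smooth_on S F \<longleftrightarrow> (\<forall>n. Ck_on n F S)"


section \<open>Manifolds\<close>

text \<open>
  The points of the manifold are the elements of the type \<open>'m\<close>. A chart is a pair
  \<open>(U, \<phi>)\<close>; the values of \<open>\<phi>\<close> outside \<open>U\<close> play no role, and the inverse of \<open>\<phi>\<close> is
  \<open>inv_into U \<phi>\<close>.
\<close>

type_synonym ('m, 'e) chart = "'m set \<times> ('m \<Rightarrow> 'e)"

definition is_chart :: "('m::topological_space, 'e::real_normed_vector) chart \<Rightarrow> bool"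
  where "is_chart = (\<lambda>(U, \<phi>). open U \<and> open (\<phi> ` U) \<and> homeomorphism U (\<phi> ` U) \<phi> (inv_into U \<phi>))"

definition transition :: "('m, 'e) chart \<Rightarrow> ('m, 'e) chart \<Rightarrow> 'e \<Rightarrow> 'e"
  where "transition \<kappa> \<kappa>' = snd \<kappa>' \<circ> inv_into (fst \<kappa>) (snd \<kappa>)"

definition compatible ::
    "('m, 'e::real_normed_vector) chart \<Rightarrow> ('m, 'e) chart \<Rightarrow> bool"
  where "compatible \<kappa> \<kappa>' \<longleftrightarrow>
    smooth_on (snd \<kappa> ` (fst \<kappa> \<inter> fst \<kappa>')) (transition \<kappa> \<kappa>') \<and>
    smooth_on (snd \<kappa>' ` (fst \<kappa> \<inter> fst \<kappa>')) (transition \<kappa>' \<kappa>)"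

definition smooth_structure ::
    "('m::topological_space, 'e::real_normed_vector) chart set \<Rightarrow> bool"
  where "smooth_structure \<A> \<longleftrightarrow>
    (\<forall>\<kappa>\<in>\<A>. is_chart \<kappa>) \<and>
    (\<Union>\<kappa>\<in>\<A>. fst \<kappa>) = UNIV \<and>
    (\<forall>\<kappa>\<in>\<A>. \<forall>\<kappa>'\<in>\<A>. compatible \<kappa> \<kappa>') \<and>
    (\<forall>\<kappa>. is_chart \<kappa> \<and> (\<forall>\<kappa>'\<in>\<A>. compatible \<kappa> \<kappa>') \<longrightarrow> \<kappa> \<in> \<A>)"

definition paracompact :: "'m::topological_space itself \<Rightarrow> bool"
  where "paracompact _ \<longleftrightarrow>
    (\<forall>\<U> :: 'm set set. (\<forall>U\<in>\<U>. open U) \<and> \<Union>\<U> = UNIV \<longrightarrow>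
      (\<exists>\<V>. (\<forall>V\<in>\<V>. open V \<and> (\<exists>U\<in>\<U>. V \<subseteq> U)) \<and> \<Union>\<V> = UNIV \<and>
        locally_finite_in euclidean \<V>))"

definition finite_dimensional :: "'e::real_vector itself \<Rightarrow> bool"
  where "finite_dimensional _ \<longleftrightarrow> (\<exists>B :: 'e set. finite B \<and> span B = UNIV)"

definition fun_rep :: "('m, 'e) chart \<Rightarrow> ('m \<Rightarrow> 'b) \<Rightarrow> 'e \<Rightarrow> 'b"
  where "fun_rep \<kappa> f = f \<circ> inv_into (fst \<kappa>) (snd \<kappa>)"

definition sec_rep :: "('m, 'e) chart \<Rightarrow> ('m \<Rightarrow> ('m, 'e) chart \<Rightarrow> 'b) \<Rightarrow> 'e \<Rightarrow> 'b"
  where "sec_rep \<kappa> \<sigma> u = \<sigma> (inv_into (fst \<kappa>) (snd \<kappa>) u) \<kappa>"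

definition smooth_functions ::
    "('m, 'e::real_normed_vector) chart set \<Rightarrow> ('m \<Rightarrow> real) set"
  where "smooth_functions \<A> = {f. \<forall>\<kappa>\<in>\<A>. smooth_on (snd \<kappa> ` fst \<kappa>) (fun_rep \<kappa> f)}"


section \<open>Tangent vectors and the second-order tangent bundle\<close>

text \<open>
  An element of a fibre over \<open>m\<close> is represented by the family of its local representatives in
  all charts at \<open>m\<close>, with value \<open>0\<close> at all other pairs so that equality of elements is
  equality of families.
\<close>

type_synonym ('m, 'e) tvec = "('m, 'e) chart \<Rightarrow> 'e"
type_synonym ('m, 'e) tvec2 = "('m, 'e) chart \<Rightarrow> 'e \<times> 'e sym2"

definition tangent_space ::
    "('m, 'e::real_normed_vector) chart set \<Rightarrow> 'm \<Rightarrow> ('m, 'e) tvec set"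
  where "tangent_space \<A> m = {v.
    (\<forall>\<kappa>. \<not> (\<kappa> \<in> \<A> \<and> m \<in> fst \<kappa>) \<longrightarrow> v \<kappa> = 0) \<and>
    (\<forall>\<kappa>\<in>\<A>. \<forall>\<kappa>'\<in>\<A>. m \<in> fst \<kappa> \<inter> fst \<kappa>' \<longrightarrow>
      v \<kappa>' = D1 (transition \<kappa> \<kappa>') (snd \<kappa> m) (v \<kappa>))}"

definition tangent2_space ::
    "('m, 'e::real_normed_vector) chart set \<Rightarrow> 'm \<Rightarrow> ('m, 'e) tvec2 set"
  where "tangent2_space \<A> m = {\<tau>.
    (\<forall>\<kappa>. \<not> (\<kappa> \<in> \<A> \<and> m \<in> fst \<kappa>) \<longrightarrow> \<tau> \<kappa> = 0) \<and>
    (\<forall>\<kappa>\<in>\<A>. \<forall>\<kappa>'\<in>\<A>. m \<in> fst \<kappa> \<inter> fst \<kappa>' \<longrightarrow>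
      (let F = transition \<kappa> \<kappa>'; u = snd \<kappa> m; (e, s) = \<tau> \<kappa> in
        \<tau> \<kappa>' = (D1 F u e + sym_lin (D2 F u) s, sym_lin (\<lambda>y z. D1 F u y \<Delta> D1 F u z) s)))}"

definition vector_fields ::
    "('m, 'e::real_normed_vector) chart set \<Rightarrow> ('m \<Rightarrow> ('m, 'e) tvec) set"
  where "vector_fields \<A> = {X. (\<forall>m. X m \<in> tangent_space \<A> m) \<and>
    (\<forall>\<kappa>\<in>\<A>. smooth_on (snd \<kappa> ` fst \<kappa>) (sec_rep \<kappa> X))}"

definition sections2 ::
    "('m, 'e::real_normed_vector) chart set \<Rightarrow> ('m \<Rightarrow> ('m, 'e) tvec2) set"
  where "sections2 \<A> = {\<tau>. (\<forall>m. \<tau> m \<in> tangent2_space \<A> m) \<and>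
    (\<forall>\<kappa>\<in>\<A>. smooth_on (snd \<kappa> ` fst \<kappa>) (sec_rep \<kappa> \<tau>))}"


section \<open>Special second-order connections\<close>

type_synonym ('m, 'e) connection2 =
  "('m \<Rightarrow> ('m, 'e) tvec) \<Rightarrow> ('m \<Rightarrow> ('m, 'e) tvec2) \<Rightarrow> 'm \<Rightarrow> ('m, 'e) tvec2"

definition koszul_connection ::
    "('m, 'e::real_normed_vector) chart set \<Rightarrow> ('m, 'e) connection2 \<Rightarrow> bool"
  where "koszul_connection \<A> N \<longleftrightarrow>
    (\<forall>X\<in>vector_fields \<A>. \<forall>\<tau>\<in>sections2 \<A>. N X \<tau> \<in> sections2 \<A>) \<and>
    (\<forall>X\<in>vector_fields \<A>. \<forall>Y\<in>vector_fields \<A>. \<forall>\<tau>\<in>sections2 \<A>.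
      N (\<lambda>m \<kappa>. X m \<kappa> + Y m \<kappa>) \<tau> = (\<lambda>m \<kappa>. N X \<tau> m \<kappa> + N Y \<tau> m \<kappa>)) \<and>
    (\<forall>f\<in>smooth_functions \<A>. \<forall>X\<in>vector_fields \<A>. \<forall>\<tau>\<in>sections2 \<A>.
      N (\<lambda>m \<kappa>. f m *\<^sub>R X m \<kappa>) \<tau> = (\<lambda>m \<kappa>. f m *\<^sub>R N X \<tau> m \<kappa>)) \<and>
    (\<forall>X\<in>vector_fields \<A>. \<forall>\<sigma>\<in>sections2 \<A>. \<forall>\<tau>\<in>sections2 \<A>.
      N X (\<lambda>m \<kappa>. \<sigma> m \<kappa> + \<tau> m \<kappa>) = (\<lambda>m \<kappa>. N X \<sigma> m \<kappa> + N X \<tau> m \<kappa>)) \<and>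
    (\<forall>f\<in>smooth_functions \<A>. \<forall>X\<in>vector_fields \<A>. \<forall>\<tau>\<in>sections2 \<A>.
      N X (\<lambda>m \<kappa>. f m *\<^sub>R \<tau> m \<kappa>) =
        (\<lambda>m \<kappa>. D1 (fun_rep \<kappa> f) (snd \<kappa> m) (X m \<kappa>) *\<^sub>R \<tau> m \<kappa> + f m *\<^sub>R N X \<tau> m \<kappa>))"

type_synonym ('m, 'e) conn_form = "('m, 'e) chart \<Rightarrow> 'e \<Rightarrow> 'e \<Rightarrow> 'e \<times> 'e sym2 \<Rightarrow> 'e \<times> 'e sym2"
type_synonym ('m, 'e) christoffel_R = "('m, 'e) chart \<Rightarrow> 'e \<Rightarrow> 'e \<Rightarrow> 'e sym2 \<Rightarrow> 'e"
type_synonym ('m, 'e) christoffel_C = "('m, 'e) chart \<Rightarrow> 'e \<Rightarrow> 'e \<Rightarrow> 'e sym2 \<Rightarrow> 'e sym2"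

definition has_conn_form ::
    "('m, 'e::real_normed_vector) chart set \<Rightarrow> ('m, 'e) connection2 \<Rightarrow> ('m, 'e) conn_form \<Rightarrow> bool"
  where "has_conn_form \<A> N \<Gamma> \<longleftrightarrow>
    (\<forall>X\<in>vector_fields \<A>. \<forall>\<tau>\<in>sections2 \<A>. \<forall>\<kappa>\<in>\<A>. \<forall>m\<in>fst \<kappa>.
      N X \<tau> m \<kappa> = D1 (sec_rep \<kappa> \<tau>) (snd \<kappa> m) (X m \<kappa>) - \<Gamma> \<kappa> (snd \<kappa> m) (X m \<kappa>) (\<tau> m \<kappa>))"

definition special_form ::
    "('m, 'e::real_normed_vector) christoffel_R \<Rightarrow> ('m, 'e) christoffel_C \<Rightarrow> ('m, 'e) conn_form"
  where "special_form R C \<kappa> u x = (\<lambda>(v, s). (R \<kappa> u x s, - (x \<Delta> v) + C \<kappa> u x s))"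

definition has_christoffel ::
    "('m, 'e::real_normed_vector) chart set \<Rightarrow> ('m, 'e) connection2 \<Rightarrow>
      ('m, 'e) christoffel_R \<Rightarrow> ('m, 'e) christoffel_C \<Rightarrow> bool"
  where "has_christoffel \<A> N R C \<longleftrightarrow>
    has_conn_form \<A> N (special_form R C) \<and>
    (\<forall>\<kappa>\<in>\<A>. \<forall>u\<in>snd \<kappa> ` fst \<kappa>. bilinear (R \<kappa> u) \<and> bilinear (C \<kappa> u)) \<and>
    (\<forall>\<kappa>\<in>\<A>. \<forall>x s. smooth_on (snd \<kappa> ` fst \<kappa>) (\<lambda>u. R \<kappa> u x s) \<and>
      smooth_on (snd \<kappa> ` fst \<kappa>) (\<lambda>u. C \<kappa> u x s))"

definition special_second_order_connection ::
    "('m, 'e::real_normed_vector) chart set \<Rightarrow> ('m, 'e) connection2 \<Rightarrow> bool"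
  where "special_second_order_connection \<A> N \<longleftrightarrow>
    koszul_connection \<A> N \<and> (\<exists>R C. has_christoffel \<A> N R C)"

text \<open>
  On a Hausdorff manifold every value in a fibre extends to a global vector field or section, so at
  base points in the image of a chart the Christoffel symbols of a special second-order connection
  are uniquely determined; the choice below only concerns irrelevant arguments.
\<close>

definition christoffel ::
    "('m, 'e::real_normed_vector) chart set \<Rightarrow> ('m, 'e) connection2 \<Rightarrow>
      ('m, 'e) christoffel_R \<times> ('m, 'e) christoffel_C"
  where "christoffel \<A> N = (SOME (R, C). has_christoffel \<A> N R C)"

definition conn_form_of ::
    "('m, 'e::real_normed_vector) chart set \<Rightarrow> ('m, 'e) connection2 \<Rightarrow> ('m, 'e) conn_form"
  where "conn_form_of \<A> N = (case christoffel \<A> N of (R, C) \<Rightarrow> special_form R C)"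


section \<open>The associated Hessian structure\<close>

type_synonym ('m, 'e) hessian3 =
  "('m \<Rightarrow> real) \<Rightarrow> 'm \<Rightarrow> ('m, 'e) tvec \<Rightarrow> ('m, 'e) tvec \<Rightarrow> ('m, 'e) tvec \<Rightarrow> real"

definition associated_hessian ::
    "('m, 'e::real_normed_vector) chart set \<Rightarrow> ('m, 'e) connection2 \<Rightarrow> ('m, 'e) hessian3 \<Rightarrow> bool"
  where "associated_hessian \<A> N K \<longleftrightarrow>
    (\<forall>f\<in>smooth_functions \<A>. \<forall>m. \<forall>X\<in>tangent_space \<A> m. \<forall>Y\<in>tangent_space \<A> m.
      \<forall>Z\<in>tangent_space \<A> m. \<forall>\<kappa>\<in>\<A>. m \<in> fst \<kappa> \<longrightarrow>
      (let F = fun_rep \<kappa> f; u = snd \<kappa> m; (R, C) = christoffel \<A> N in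
        K f m X Y Z = D3 F u (X \<kappa>) (Y \<kappa>) (Z \<kappa>)
          + sym_lin (D2 F u) (C \<kappa> u (X \<kappa>) (Y \<kappa> \<Delta> Z \<kappa>))
          + D1 F u (R \<kappa> u (X \<kappa>) (Y \<kappa> \<Delta> Z \<kappa>))))"

definition symmetric_hessian ::
    "('m, 'e::real_normed_vector) chart set \<Rightarrow> ('m, 'e) hessian3 \<Rightarrow> bool"
  where "symmetric_hessian \<A> K \<longleftrightarrow>
    (\<forall>f\<in>smooth_functions \<A>. \<forall>m. \<forall>X\<in>tangent_space \<A> m. \<forall>Y\<in>tangent_space \<A> m.
      \<forall>Z\<in>tangent_space \<A> m. K f m X Y Z = K f m Y X Z \<and> K f m X Y Z = K f m X Z Y)"


section \<open>Second-order geodesics\<close>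

definition smooth_curve ::
    "('m::topological_space, 'e::real_normed_vector) chart set \<Rightarrow> real set \<Rightarrow> (real \<Rightarrow> 'm) \<Rightarrow> bool"
  where "smooth_curve \<A> J c \<longleftrightarrow> open J \<and> is_interval J \<and> continuous_on J c \<and>
    (\<forall>\<kappa>\<in>\<A>. smooth_on {t\<in>J. c t \<in> fst \<kappa>} (snd \<kappa> \<circ> c))"

definition velocity ::
    "('m, 'e::real_normed_vector) chart set \<Rightarrow> (real \<Rightarrow> 'm) \<Rightarrow> real \<Rightarrow> ('m, 'e) tvec"
  where "velocity \<A> c t \<kappa> =
    (if \<kappa> \<in> \<A> \<and> c t \<in> fst \<kappa> then vector_derivative (snd \<kappa> \<circ> c) (at t) else 0)"

text \<open>The section of the second-order tangent bundle along \<open>c\<close> written as \<open>c\<close> with two dots.\<close>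

definition acceleration ::
    "('m, 'e::real_normed_vector) chart set \<Rightarrow> (real \<Rightarrow> 'm) \<Rightarrow> real \<Rightarrow> ('m, 'e) tvec2"
  where "acceleration \<A> c t \<kappa> =
    (if \<kappa> \<in> \<A> \<and> c t \<in> fst \<kappa>
     then let c1 = (\<lambda>r. vector_derivative (snd \<kappa> \<circ> c) (at r))
          in (vector_derivative c1 (at t), c1 t \<Delta> c1 t)
     else 0)"

text \<open>
  Covariant derivative, along \<open>c\<close>, of a section \<open>\<sigma>\<close> along \<open>c\<close>: in a chart it is the local
  formula of the connection, with the derivative in direction \<open>X\<close> replaced by the derivative in
  the parameter.
\<close>

definition covariant_along ::
    "('m, 'e::real_normed_vector) chart set \<Rightarrow> ('m, 'e) connection2 \<Rightarrow> (real \<Rightarrow> 'm) \<Rightarrow>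
      (real \<Rightarrow> ('m, 'e) tvec2) \<Rightarrow> real \<Rightarrow> ('m, 'e) tvec2"
  where "covariant_along \<A> N c \<sigma> t \<kappa> =
    (if \<kappa> \<in> \<A> \<and> c t \<in> fst \<kappa>
     then vector_derivative (\<lambda>r. \<sigma> r \<kappa>) (at t)
       - conn_form_of \<A> N \<kappa> (snd \<kappa> (c t)) (velocity \<A> c t \<kappa>) (\<sigma> t \<kappa>)
     else 0)"

definition second_order_geodesic ::
    "('m::topological_space, 'e::real_normed_vector) chart set \<Rightarrow> ('m, 'e) connection2 \<Rightarrow>
      real set \<Rightarrow> (real \<Rightarrow> 'm) \<Rightarrow> bool"
  where "second_order_geodesic \<A> N J c \<longleftrightarrow> smooth_curve \<A> J c \<and>
    (\<forall>t\<in>J. covariant_along \<A> N c (acceleration \<A> c) t = (\<lambda>_. 0))"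

end

theory Submission
  imports Defs
begin

text \<open>
  In a chart around \<open>m\<close>, with \<open>F\<close> and \<open>\<gamma>\<close> the representatives of \<open>f\<close> and \<open>c\<close>, the chain rule and the
  symmetry of \<open>D\<^sup>2F\<close> give
  \<open>(F \<circ> \<gamma>)''' = D\<^sup>3F(\<gamma>', \<gamma>', \<gamma>') + 3 D\<^sup>2F(\<gamma>', \<gamma>'') + DF \<gamma>'''\<close>. The geodesic equations
  \<open>\<gamma>''' = R(\<gamma>', \<gamma>', \<gamma>')\<close> and \<open>3 \<gamma>' \<Delta> \<gamma>'' = C(\<gamma>', \<gamma>', \<gamma>')\<close> turn the right-hand side into the local
  formula for \<open>K f\<close>.
\<close>

section \<open>Smooth maps\<close>

lemma has_derivative_D1:
  assumes "F differentiable (at u)"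
  shows "(F has_derivative D1 F u) (at u)"
  using assms unfolding frechet_derivative_works D1_def by (simp add: eta_contract_eq)

lemma D1_eqI:
  assumes "(F has_derivative F') (at u)"
  shows "D1 F u = F'"
  using frechet_derivative_at[OF assms] by (auto simp: D1_def)

lemma linear_D1:
  assumes "F differentiable (at u)"
  shows "linear (D1 F u)"
  using has_derivative_D1[OF assms] has_derivative_linear by blast

text \<open>Derivatives in \<open>Ck_on\<close> are taken in the ambient space, and openness of
  \<open>S\<close> makes the two maps agree near each point of \<open>S\<close>. The functions stay
  arbitrary in the induction because its hypothesis is applied to directional derivatives.\<close>

lemma Ck_on_cong:
  assumes "open S" "\<And>u. u \<in> S \<Longrightarrow> F u = G u" "Ck_on n F S"
  shows "Ck_on n G S"
  using assms(2,3)
proof (induction n arbitrary: F G)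
  case 0
  then show ?case using continuous_on_cong[of S S F G] by simp
next
  case (Suc n)
  have der: "(G has_derivative D1 F u) (at u)" if "u \<in> S" for u
    using has_derivative_transform_within_open[OF has_derivative_D1 assms(1) that] Suc.prems that by auto
  then have "D1 F u = D1 G u" if "u \<in> S" for u using D1_eqI that by metis
  then have "Ck_on n (\<lambda>u. D1 G u x) S" for x
    using Suc.IH[of "\<lambda>u. D1 F u x" "\<lambda>u. D1 G u x"] Suc.prems(2) by auto
  then show ?case using der by (auto simp: differentiable_def)
qed

lemma smooth_onD:
  assumes "smooth_on S F"
  shows smooth_on_continuous: "continuous_on S F"
    and smooth_on_differentiable: "u \<in> S \<Longrightarrow> F differentiable (at u)"
    and smooth_on_D1: "smooth_on S (\<lambda>u. D1 F u x)"
  using assms unfolding smooth_on_def by (metis Ck_on.simps(1), metis Ck_on.simps(2), metis Ck_on.simps(2))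

lemma smooth_on_D2:
  assumes "smooth_on S F"
  shows "smooth_on S (\<lambda>u. D2 F u x y)"
  unfolding D2_def by (intro smooth_on_D1 assms)

lemma smooth_on_has_vector_derivative:
  assumes "smooth_on T g" "t \<in> T"
  shows "(g has_vector_derivative vector_derivative g (at t)) (at t)"
proof -
  have "(g has_vector_derivative D1 g t 1) (at t)"
    using has_derivative_D1[OF smooth_on_differentiable[OF assms]]
      linear_scale[OF linear_D1[OF smooth_on_differentiable[OF assms]], of _ 1, symmetric]
    by (simp add: has_vector_derivative_def)
  then show ?thesis using vector_derivative_at by fastforce
qed

text \<open>Links the derivative used for curves to the one in \<open>Ck_on\<close>: on
  \<open>T\<close> it is the directional derivative \<open>D1 g t 1\<close>, which is again
  smooth.\<close>

lemma smooth_on_vector_derivative: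
  assumes "open T" "smooth_on T g"
  shows "smooth_on T (\<lambda>t. vector_derivative g (at t))"
proof -
  have "D1 g t 1 = vector_derivative g (at t)" if "t \<in> T" for t
    using D1_eqI[OF smooth_on_has_vector_derivative[OF assms(2) that, unfolded has_vector_derivative_def]]
    by simp
  then show ?thesis
    using smooth_on_D1[OF assms(2), of 1]
      Ck_on_cong[OF assms(1), of "\<lambda>t. D1 g t 1" "\<lambda>t. vector_derivative g (at t)"]
    unfolding smooth_on_def by blast
qed

section \<open>Symmetry of the second derivative\<close>

text \<open>The mean value theorem is applied twice, first along \<open>x\<close> to the increment
  of \<open>F\<close> in direction \<open>y\<close>, then along \<open>y\<close> to the directional
  derivative of \<open>F\<close> in direction \<open>x\<close>.\<close>

lemma second_difference:
  fixes F :: "'a::real_normed_vector \<Rightarrow> real"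
  assumes F: "\<And>w. w \<in> ball u r \<Longrightarrow> F differentiable (at w)"
    and DF: "\<And>w. w \<in> ball u r \<Longrightarrow> (\<lambda>w. D1 F w x) differentiable (at w)"
    and h: "h > 0" "h * (norm x + norm y) < r"
  obtains w where "w \<in> ball u r"
    and "F (u + h *\<^sub>R x + h *\<^sub>R y) - F (u + h *\<^sub>R x) - F (u + h *\<^sub>R y) + F u = h\<^sup>2 * D2 F w y x"
proof -
  \<comment> \<open>The whole parallelogram spanned by \<open>h *\<^sub>R x\<close> and
    \<open>h *\<^sub>R y\<close> at \<open>u\<close> lies in the ball, so both applications stay
    where the derivatives exist.\<close>
  have inball: "u + a *\<^sub>R x + b *\<^sub>R y \<in> ball u r" if "0 \<le> a" "a \<le> h" "0 \<le> b" "b \<le> h" for a b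
  proof -
    have "norm (a *\<^sub>R x + b *\<^sub>R y) \<le> a * norm x + b * norm y"
      using norm_triangle_ineq[of "a *\<^sub>R x" "b *\<^sub>R y"] that by simp
    also have "\<dots> \<le> h * norm x + h * norm y"
      by (intro add_mono mult_right_mono that) auto
    also have "\<dots> < r" using h by (simp add: algebra_simps)
    finally show ?thesis
      using norm_minus_cancel[of "a *\<^sub>R x + b *\<^sub>R y"] by (simp add: dist_norm add.assoc)
  qed
  have line: "((\<lambda>a. G (p + a *\<^sub>R z)) has_derivative (\<lambda>k. k * D1 G (p + a *\<^sub>R z) z)) (at a within I)"
    if "G differentiable (at (p + a *\<^sub>R z))" for G :: "'a \<Rightarrow> real" and p z a I
  proof -
    have "((\<lambda>a. p + a *\<^sub>R z) has_derivative (\<lambda>k. k *\<^sub>R z)) (at a within I)"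
      by (auto intro!: derivative_eq_intros)
    from has_derivative_compose[OF this has_derivative_D1[OF that]]
    show ?thesis using linear_scale[OF linear_D1[OF that]] by simp
  qed
  \<comment> \<open>The second difference is \<open>\<phi> h - \<phi> 0\<close>.\<close>
  define \<phi> where "\<phi> a = F (u + h *\<^sub>R y + a *\<^sub>R x) - F (u + a *\<^sub>R x)" for a
  have "\<exists>a\<in>{0<..<h}. \<phi> h - \<phi> 0 =
      (h - 0) * D1 F (u + h *\<^sub>R y + a *\<^sub>R x) x - (h - 0) * D1 F (u + a *\<^sub>R x) x"
    unfolding \<phi>_def
  proof (rule mvt_simple[OF h(1)])
    fix a assume a: "0 \<le> a" "a \<le> h"
    show "((\<lambda>a. F (u + h *\<^sub>R y + a *\<^sub>R x) - F (u + a *\<^sub>R x)) has_derivative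
        (\<lambda>k. k * D1 F (u + h *\<^sub>R y + a *\<^sub>R x) x - k * D1 F (u + a *\<^sub>R x) x)) (at a within {0..h})"
      using inball[of a 0] inball[of a h] a h
      by (intro has_derivative_diff line F) (auto simp: algebra_simps)
  qed
  then obtain a where a: "0 < a" "a < h"
    and 1: "\<phi> h - \<phi> 0 = h * (D1 F (u + a *\<^sub>R x + h *\<^sub>R y) x - D1 F (u + a *\<^sub>R x) x)"
    by (auto simp: algebra_simps)
  have "\<exists>b\<in>{0<..<h}. D1 F (u + a *\<^sub>R x + h *\<^sub>R y) x - D1 F (u + a *\<^sub>R x + 0 *\<^sub>R y) x =
      (h - 0) * D1 (\<lambda>w. D1 F w x) (u + a *\<^sub>R x + b *\<^sub>R y) y"
    by (rule mvt_simple[OF h(1)]) (use inball a in \<open>intro line DF, auto\<close>)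
  then obtain b where b: "0 < b" "b < h"
    and 2: "D1 F (u + a *\<^sub>R x + h *\<^sub>R y) x - D1 F (u + a *\<^sub>R x) x = h * D2 F (u + a *\<^sub>R x + b *\<^sub>R y) y x"
    by (auto simp: D2_def)
  show thesis
  proof (rule that)
    show "u + a *\<^sub>R x + b *\<^sub>R y \<in> ball u r" using inball a b by simp
    show "F (u + h *\<^sub>R x + h *\<^sub>R y) - F (u + h *\<^sub>R x) - F (u + h *\<^sub>R y) + F u
        = h\<^sup>2 * D2 F (u + a *\<^sub>R x + b *\<^sub>R y) y x"
      using 1 unfolding 2 by (simp add: \<phi>_def power2_eq_square algebra_simps)
  qed
qed

text \<open>The second difference does not change when \<open>x\<close> and \<open>y\<close> are
  swapped, so the two mixed derivatives take a common value, each at its own point near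
  \<open>u\<close>. By continuity this value is close to both mixed derivatives at
  \<open>u\<close>.\<close>

lemma D2_commute:
  fixes F :: "'a::real_normed_vector \<Rightarrow> real"
  assumes S: "open S" "u \<in> S" and F: "smooth_on S F"
  shows "D2 F u x y = D2 F u y x"
proof (rule ccontr)
  assume "D2 F u x y \<noteq> D2 F u y x"
  \<comment> \<open>Half the supposed gap: two errors below \<open>?e\<close> cannot add up to the
    gap.\<close>
  then have e: "\<bar>D2 F u x y - D2 F u y x\<bar> / 2 > 0" (is "?e > 0") by simp
  have cont: "\<exists>d>0. \<forall>w\<in>ball u d. \<bar>D2 F w x y - D2 F u x y\<bar> < \<epsilon>" if \<epsilon>: "\<epsilon> > 0" for x y \<epsilon>
  proof -
    have "isCont (\<lambda>w. D2 F w x y) u"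
      using smooth_on_continuous[OF smooth_on_D2[OF F]] S continuous_on_eq_continuous_at by blast
    then obtain d where "d > 0" "\<And>w. dist w u < d \<Longrightarrow> \<bar>D2 F w x y - D2 F u x y\<bar> < \<epsilon>"
      using \<epsilon> unfolding continuous_at_eps_delta dist_real_def by blast
    then show ?thesis by (auto intro!: exI[of _ d] simp only: mem_ball dist_commute[of u])
  qed
  obtain d1 where d1: "d1 > 0" "\<And>w. w \<in> ball u d1 \<Longrightarrow> \<bar>D2 F w x y - D2 F u x y\<bar> < ?e"
    using cont[OF e, of x y] by blast
  obtain d2 where d2: "d2 > 0" "\<And>w. w \<in> ball u d2 \<Longrightarrow> \<bar>D2 F w y x - D2 F u y x\<bar> < ?e"
    using cont[OF e, of y x] by blast
  obtain d3 where d3: "d3 > 0" "ball u d3 \<subseteq> S" using S by (meson openE)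
  define r where "r = min d1 (min d2 d3)"
  \<comment> \<open>The summand 1 keeps the denominator positive when \<open>x\<close> and
    \<open>y\<close> vanish; the factor 2 makes the bound by \<open>r\<close> strict.\<close>
  define h where "h = r / (2 * (norm x + norm y + 1))"
  have r: "r > 0" using d1 d2 d3 by (simp add: r_def)
  have den: "norm x + norm y + 1 > 0" using norm_ge_zero[of x] norm_ge_zero[of y] by linarith
  have h: "h > 0" using r den by (simp add: h_def)
  have hr: "h * (norm x + norm y) < r"
  proof -
    have "h * (norm x + norm y) \<le> h * (norm x + norm y + 1)" using h by (intro mult_left_mono) auto
    also have "\<dots> = r / 2" using den by (simp add: h_def field_simps)
    finally show ?thesis using r by simp
  qed
  have B: "w \<in> S" if "w \<in> ball u r" for w using that d3 by (auto simp: r_def)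
  note diff = smooth_on_differentiable[OF F B] smooth_on_differentiable[OF smooth_on_D1[OF F] B]
  obtain w where w: "w \<in> ball u r"
    "F (u + h *\<^sub>R x + h *\<^sub>R y) - F (u + h *\<^sub>R x) - F (u + h *\<^sub>R y) + F u = h\<^sup>2 * D2 F w y x"
    using second_difference[OF diff h hr] by blast
  have "h * (norm y + norm x) < r" using hr by (simp add: add.commute)
  from second_difference[OF diff h this] obtain w' where w': "w' \<in> ball u r"
    "F (u + h *\<^sub>R y + h *\<^sub>R x) - F (u + h *\<^sub>R y) - F (u + h *\<^sub>R x) + F u = h\<^sup>2 * D2 F w' x y"
    by blast
  have "h\<^sup>2 * D2 F w y x = h\<^sup>2 * D2 F w' x y"
    using w(2) w'(2) by (simp add: algebra_simps)
  then have "D2 F w y x = D2 F w' x y" using h by simp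
  moreover have "\<bar>D2 F w y x - D2 F u y x\<bar> < ?e" using d2 w(1) by (auto simp: r_def)
  moreover have "\<bar>D2 F w' x y - D2 F u x y\<bar> < ?e" using d1 w'(1) by (auto simp: r_def)
  moreover have "\<bar>D2 F u x y - D2 F u y x\<bar>
      \<le> \<bar>D2 F w y x - D2 F u y x\<bar> + \<bar>D2 F w y x - D2 F u x y\<bar>"
    using abs_triangle_ineq4[of "D2 F w y x - D2 F u y x" "D2 F w y x - D2 F u x y"]
    by (simp add: algebra_simps)
  ultimately show False by simp
qed

text \<open>Linearity in the outer direction is linearity of a derivative; symmetry transfers it to
  the inner direction.\<close>

lemma bilinear_D2:
  fixes F :: "'a::real_normed_vector \<Rightarrow> real"
  assumes "open S" "u \<in> S" "smooth_on S F"
  shows "bilinear (D2 F u)"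
proof -
  have 1: "linear (\<lambda>x. D2 F u x y)" for y
    unfolding D2_def
    using linear_D1[OF smooth_on_differentiable[OF smooth_on_D1[OF assms(3)] assms(2)]]
    by (simp add: eta_contract_eq)
  moreover have "linear (D2 F u x)" for x
    using 1[of x] unfolding D2_commute[OF assms, of _ x] by (simp add: eta_contract_eq)
  ultimately show ?thesis by (auto simp: bilinear_def eta_contract_eq)
qed

section \<open>Derivatives along curves\<close>

lemma has_vector_derivative_D1:
  assumes "F differentiable (at (g t))" "(g has_vector_derivative g') (at t)"
  shows "((\<lambda>s. F (g s)) has_vector_derivative D1 F (g t) g') (at t)"
  using has_derivative_compose[OF assms(2)[unfolded has_vector_derivative_def] has_derivative_D1[OF assms(1)]]
    linear_scale[OF linear_D1[OF assms(1)]]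
  by (simp add: has_vector_derivative_def)

section \<open>Product rule for families of linear maps along a curve\<close>

lemma finite_dimensional_coordinates:
  assumes "finite_dimensional TYPE('e)"
  obtains C :: "'e::real_normed_vector set" and e :: "'e \<Rightarrow> 'e \<Rightarrow> real"
  where "finite C" "\<And>b. bounded_linear (e b)" "\<And>x. (\<Sum>b\<in>C. e b x *\<^sub>R b) = x"
proof -
  obtain B :: "'e set" where B: "finite B" "span B = UNIV"
    using assms unfolding finite_dimensional_def by blast
  obtain C :: "'e set" where C: "independent C" "span C = (UNIV :: 'e set)"
    using basis_exists[of "UNIV :: 'e set"] by (metis top.extremum_uniqueI)
  have fin: "finite C" using independent_span_bound[OF B(1) C(1)] B(2) by auto
  show thesis
  proof (rule that[OF fin, of "\<lambda>b x. representation C x b"])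
    have "linear (\<lambda>x. representation C x b)" for b
      by (rule linearI) (simp_all add: C representation_add representation_scale)
    then show "bounded_linear (\<lambda>x. representation C x b)" for b
      by (rule bounded_linear_finite_dim[OF B])
    show "(\<Sum>b\<in>C. representation C x b *\<^sub>R b) = x" for x
      by (rule sum_representation_eq[OF C(1) _ fin]) (auto simp: C)
  qed
qed

text \<open>Coordinates turn \<open>G s (y s)\<close> into a finite sum of scalar functions times
  \<open>G s b\<close>, so it is enough to differentiate \<open>G\<close> at each fixed vector. This
  matches \<open>Ck_on\<close>, which treats directional derivatives one direction at a
  time.\<close>

lemma has_vector_derivative_linear_family:
  fixes G :: "real \<Rightarrow> 'e::real_normed_vector \<Rightarrow> 'b::real_normed_vector"
  assumes fin: "finite_dimensional TYPE('e)" and T: "open T" "t \<in> T"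
    and lin: "\<And>s. s \<in> T \<Longrightarrow> linear (G s)"
    and G: "\<And>x. ((\<lambda>s. G s x) has_vector_derivative G' x) (at t)"
    and y: "(y has_vector_derivative y') (at t)"
  shows "((\<lambda>s. G s (y s)) has_vector_derivative G' (y t) + G t y') (at t)"
proof -
  obtain C :: "'e set" and e :: "'e \<Rightarrow> 'e \<Rightarrow> real"
    where C: "finite C" "\<And>b. bounded_linear (e b)" "\<And>x. (\<Sum>b\<in>C. e b x *\<^sub>R b) = x"
    using finite_dimensional_coordinates[OF fin] by blast
  have expand: "G s x = (\<Sum>b\<in>C. e b x *\<^sub>R G s b)" if "s \<in> T" for s x
  proof -
    have "G s x = G s (\<Sum>b\<in>C. e b x *\<^sub>R b)" by (simp add: C(3))
    then show ?thesis using lin[OF that] by (simp add: linear_sum linear_cmul)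
  qed
  \<comment> \<open>Uniqueness of the derivative will give \<open>G'\<close> the same coordinate
    expansion as \<open>G\<close>.\<close>
  have "((\<lambda>s. \<Sum>b\<in>C. e b x *\<^sub>R G s b) has_vector_derivative (\<Sum>b\<in>C. e b x *\<^sub>R G' b)) (at t)" for x
    by (intro has_vector_derivative_sum)
       (use bounded_linear.has_vector_derivative[OF bounded_linear_scaleR_right G] in blast)
  then have "((\<lambda>s. G s x) has_vector_derivative (\<Sum>b\<in>C. e b x *\<^sub>R G' b)) (at t)" for x
    by (rule has_vector_derivative_transform_within_open[OF _ T]) (simp add: expand[symmetric])
  then have G': "G' x = (\<Sum>b\<in>C. e b x *\<^sub>R G' b)" for x
    using vector_derivative_unique_at[OF G] by blast
  have ey: "((\<lambda>s. e b (y s)) has_real_derivative e b y') (at t)" for b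
    using bounded_linear.has_vector_derivative[OF C(2) y]
    by (simp add: has_real_derivative_iff_has_vector_derivative)
  have "((\<lambda>s. \<Sum>b\<in>C. e b (y s) *\<^sub>R G s b) has_vector_derivative
      (\<Sum>b\<in>C. e b (y t) *\<^sub>R G' b + e b y' *\<^sub>R G t b)) (at t)"
    by (intro has_vector_derivative_sum has_vector_derivative_scaleR ey G)
  then have "((\<lambda>s. \<Sum>b\<in>C. e b (y s) *\<^sub>R G s b) has_vector_derivative G' (y t) + G t y') (at t)"
    by (simp add: sum.distrib G'[symmetric] expand[OF T(2), symmetric])
  then show ?thesis
    by (rule has_vector_derivative_transform_within_open[OF _ T]) (simp add: expand[symmetric])
qed

lemma has_vector_derivative_D1_family:
  fixes F :: "'e::real_normed_vector \<Rightarrow> real"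
  assumes "finite_dimensional TYPE('e)" and F: "smooth_on W F"
    and T: "open T" "t \<in> T" "g ` T \<subseteq> W"
    and "(g has_vector_derivative g') (at t)" "(y has_vector_derivative y') (at t)"
  shows "((\<lambda>s. D1 F (g s) (y s)) has_vector_derivative
    D2 F (g t) g' (y t) + D1 F (g t) y') (at t)"
proof (rule has_vector_derivative_linear_family[OF assms(1) T(1,2) _ _ assms(7)])
  show "linear (D1 F (g s))" if "s \<in> T" for s
    using T that by (intro linear_D1 smooth_on_differentiable[OF F]) auto
  show "((\<lambda>s. D1 F (g s) x) has_vector_derivative D2 F (g t) g' x) (at t)" for x
    unfolding D2_def using T
    by (intro has_vector_derivative_D1[of "\<lambda>w. D1 F w x"]
        smooth_on_differentiable[OF smooth_on_D1[OF F]] assms) auto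
qed

text \<open>The last slot is handled by linearity. With that slot fixed at \<open>z\<close>, the
  first-order rule applies to \<open>\<lambda>w. D1 F w z\<close>, whose first and second
  derivatives are \<open>D2\<close> and \<open>D3\<close> of \<open>F\<close> with last argument
  \<open>z\<close>.\<close>

lemma has_vector_derivative_D2_family:
  fixes F :: "'e::real_normed_vector \<Rightarrow> real"
  assumes "finite_dimensional TYPE('e)" and W: "open W" and F: "smooth_on W F"
    and T: "open T" "t \<in> T" "g ` T \<subseteq> W"
    and "(g has_vector_derivative g') (at t)" "(x has_vector_derivative x') (at t)"
    and "(y has_vector_derivative y') (at t)"
  shows "((\<lambda>s. D2 F (g s) (x s) (y s)) has_vector_derivative
    (D3 F (g t) g' (x t) (y t) + D2 F (g t) x' (y t)) + D2 F (g t) (x t) y') (at t)"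
proof (rule has_vector_derivative_linear_family[OF assms(1) T(1,2) _ _ assms(9)])
  show "linear (D2 F (g s) (x s))" if "s \<in> T" for s
    using bilinear_D2[OF W _ F] T that by (auto simp: bilinear_def)
  show "((\<lambda>s. D2 F (g s) (x s) z) has_vector_derivative
      D3 F (g t) g' (x t) z + D2 F (g t) x' z) (at t)" for z
    using has_vector_derivative_D1_family[OF assms(1) smooth_on_D1[OF F] T assms(7,8), of z]
    by (simp add: D2_def D3_def)
qed

section \<open>The third derivative of a function along a curve\<close>

lemma deriv_cube_eqI:
  fixes H :: "real \<Rightarrow> real"
  assumes T: "open T" "t \<in> T"
    and H1: "\<And>s. s \<in> T \<Longrightarrow> (H has_vector_derivative H1 s) (at s)"
    and H2: "\<And>s. s \<in> T \<Longrightarrow> (H1 has_vector_derivative H2 s) (at s)"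
    and H3: "(H2 has_vector_derivative h) (at t)"
  shows "(deriv ^^ 3) H t = h"
proof -
  \<comment> \<open>Equality on all of the open set \<open>T\<close>, not only at \<open>t\<close>,
    is what allows differentiating again.\<close>
  have "deriv H s = H1 s" if "s \<in> T" for s
    using H1[OF that] by (simp add: DERIV_imp_deriv has_real_derivative_iff_has_vector_derivative)
  then have "(deriv H has_vector_derivative H2 s) (at s)" if "s \<in> T" for s
    using has_vector_derivative_transform_within_open[OF H2[OF that] T(1) that] by simp
  then have "deriv (deriv H) s = H2 s" if "s \<in> T" for s
    using that by (simp add: DERIV_imp_deriv has_real_derivative_iff_has_vector_derivative)
  then have "(deriv (deriv H) has_vector_derivative h) (at t)"
    using has_vector_derivative_transform_within_open[OF H3 T] by simp
  then show ?thesis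
    by (simp add: numeral_3_eq_3 DERIV_imp_deriv has_real_derivative_iff_has_vector_derivative)
qed

lemma deriv_cube_compose:
  fixes F :: "'e::real_normed_vector \<Rightarrow> real"
  assumes fin: "finite_dimensional TYPE('e)" and W: "open W" and F: "smooth_on W F"
    and T: "open T" "t \<in> T" "g ` T \<subseteq> W"
    and g: "\<And>s. s \<in> T \<Longrightarrow> (g has_vector_derivative g1 s) (at s)"
    and g1: "\<And>s. s \<in> T \<Longrightarrow> (g1 has_vector_derivative g2 s) (at s)"
    and g2: "(g2 has_vector_derivative g3) (at t)"
  shows "(deriv ^^ 3) (\<lambda>s. F (g s)) t =
    D3 F (g t) (g1 t) (g1 t) (g1 t) + 3 * D2 F (g t) (g1 t) (g2 t) + D1 F (g t) g3"
proof (rule deriv_cube_eqI[OF T(1,2)])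
  show "((\<lambda>s. F (g s)) has_vector_derivative D1 F (g s) (g1 s)) (at s)" if "s \<in> T" for s
    using T that by (intro has_vector_derivative_D1 smooth_on_differentiable[OF F] g) auto
  show "((\<lambda>s. D1 F (g s) (g1 s)) has_vector_derivative
      D2 F (g s) (g1 s) (g1 s) + D1 F (g s) (g2 s)) (at s)" if "s \<in> T" for s
    by (rule has_vector_derivative_D1_family[OF fin F T(1) that T(3) g[OF that] g1[OF that]])
  have "((\<lambda>s. D2 F (g s) (g1 s) (g1 s) + D1 F (g s) (g2 s)) has_vector_derivative
      ((D3 F (g t) (g1 t) (g1 t) (g1 t) + D2 F (g t) (g2 t) (g1 t)) + D2 F (g t) (g1 t) (g2 t))
      + (D2 F (g t) (g1 t) (g2 t) + D1 F (g t) g3)) (at t)"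
    using T by (intro has_vector_derivative_add has_vector_derivative_D2_family[OF fin W F]
        has_vector_derivative_D1_family[OF fin F] g g1 g2)
  \<comment> \<open>Two mixed terms come from the arguments of \<open>D2 F\<close> and one from the
    base point of \<open>D1 F\<close>; symmetry merges them into the coefficient 3.\<close>
  moreover have "D2 F (g t) (g2 t) (g1 t) = D2 F (g t) (g1 t) (g2 t)"
    using T by (intro D2_commute[OF W _ F]) auto
  ultimately show "((\<lambda>s. D2 F (g s) (g1 s) (g1 s) + D1 F (g s) (g2 s)) has_vector_derivative
      D3 F (g t) (g1 t) (g1 t) (g1 t) + 3 * D2 F (g t) (g1 t) (g2 t) + D1 F (g t) g3) (at t)"
    by (simp add: algebra_simps)
qed

section \<open>The geodesic equations in a chart\<close>

text \<open>Boundedness makes the product rule available for \<Delta>. The constant is 1, since a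
  product acts on a form by evaluation and the norm on \<open>sym2\<close> is the operator
  norm.\<close>

lemma bounded_bilinear_sym_prod: "bounded_bilinear ((\<Delta>) :: 'a::real_normed_vector \<Rightarrow> 'a \<Rightarrow> 'a sym2)"
proof (rule bounded_bilinear.intro)
  note b = bilinear_sym_prod[where 'a = 'a]
  show "(a + a') \<Delta> b = a \<Delta> b + a' \<Delta> b" for a a' b :: 'a by (rule bilinear_ladd[OF b])
  show "a \<Delta> (b + b') = a \<Delta> b + a \<Delta> b'" for a b b' :: 'a by (rule bilinear_radd[OF b])
  show "(r *\<^sub>R a) \<Delta> b = r *\<^sub>R (a \<Delta> b)" for r and a b :: 'a by (rule bilinear_lmul[OF b])
  show "a \<Delta> (r *\<^sub>R b) = r *\<^sub>R (a \<Delta> b)" for r and a b :: 'a by (rule bilinear_rmul[OF b])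
  have "norm (a \<Delta> b) \<le> norm a * norm b * 1" for a b :: 'a
  proof (rule norm_blinfun_bound)
    fix B :: "'a sym_form"
    have "norm (Rep_sym_form B a b) \<le> norm (Rep_sym_form B a) * norm b"
      by (rule norm_blinfun)
    also have "\<dots> \<le> (norm (Rep_sym_form B) * norm a) * norm b"
      by (intro mult_right_mono norm_blinfun) simp
    finally show "norm ((a \<Delta> b) B) \<le> norm a * norm b * 1 * norm B"
      by (simp add: sym_prod.rep_eq norm_sym_form.rep_eq mult_ac)
  qed simp
  then show "\<exists>K. \<forall>a b :: 'a. norm (a \<Delta> b) \<le> norm a * norm b * K" by blast
qed

lemma has_vector_derivative_sym_prod_self:
  assumes "(g has_vector_derivative g') (at t)"
  shows "((\<lambda>s. g s \<Delta> g s) has_vector_derivative 2 *\<^sub>R (g t \<Delta> g')) (at t)"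
  using bounded_bilinear.has_vector_derivative[OF bounded_bilinear_sym_prod assms assms]
  by (simp add: sym_prod_commute[of g'] scaleR_2)

lemma open_chart_domain_along:
  assumes "smooth_curve \<A> J c" "is_chart \<kappa>"
  shows "open {t \<in> J. c t \<in> fst \<kappa>}"
proof -
  have "open (J \<inter> c -` fst \<kappa>)"
    using assms by (intro continuous_open_preimage) (auto simp: smooth_curve_def is_chart_def split_beta)
  then show ?thesis by (simp add: vimage_def Int_def)
qed

text \<open>The two equations are the components of the vanishing covariant derivative. In the
  second, differentiating \<open>g1 \<Delta> g1\<close> contributes 2 and the term
  \<open>- (x \<Delta> v)\<close> of \<open>special_form\<close> contributes 1, whence the factor
  3.\<close>

lemma second_order_geodesic_chart:
  fixes \<A> :: "('m::topological_space, 'e::real_normed_vector) chart set"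
  assumes geo: "second_order_geodesic \<A> N J c" and \<kappa>: "\<kappa> \<in> \<A>" "is_chart \<kappa>"
    and t: "t \<in> J" "c t \<in> fst \<kappa>" and RC: "christoffel \<A> N = (R, C)"
  defines "g \<equiv> snd \<kappa> \<circ> c"
  defines "g1 \<equiv> \<lambda>t. vector_derivative g (at t)"
  defines "g2 \<equiv> \<lambda>t. vector_derivative g1 (at t)"
  defines "g3 \<equiv> \<lambda>t. vector_derivative g2 (at t)"
  shows "R \<kappa> (g t) (g1 t) (g1 t \<Delta> g1 t) = g3 t"
    and "C \<kappa> (g t) (g1 t) (g1 t \<Delta> g1 t) = 3 *\<^sub>R (g1 t \<Delta> g2 t)"
proof -
  define T where "T = {t \<in> J. c t \<in> fst \<kappa>}"
  have curve: "smooth_curve \<A> J c" using geo by (simp add: second_order_geodesic_def)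
  have T: "open T" "t \<in> T"
    using open_chart_domain_along[OF curve \<kappa>(2)] t by (auto simp: T_def)
  have sm: "smooth_on T g" using curve \<kappa> by (auto simp: smooth_curve_def T_def g_def)
  have sm1: "smooth_on T g1" unfolding g1_def by (rule smooth_on_vector_derivative[OF T(1) sm])
  have sm2: "smooth_on T g2" unfolding g2_def by (rule smooth_on_vector_derivative[OF T(1) sm1])
  have acc: "acceleration \<A> c s \<kappa> = (g2 s, g1 s \<Delta> g1 s)" if "s \<in> T" for s
    using that \<kappa> by (simp add: acceleration_def T_def g2_def g1_def g_def Let_def)
  have "((\<lambda>s. (g2 s, g1 s \<Delta> g1 s)) has_vector_derivative (g3 t, 2 *\<^sub>R (g1 t \<Delta> g2 t))) (at t)"
    unfolding g3_def g2_def
    using smooth_on_has_vector_derivative[OF sm1 T(2)]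
      smooth_on_has_vector_derivative[OF sm2 T(2), unfolded g2_def]
    by (intro has_vector_derivative_Pair has_vector_derivative_sym_prod_self) auto
  \<comment> \<open>\<open>acceleration\<close> has the default value 0 where the curve is outside
    the chart, so its derivative is computed on the open set \<open>T\<close>.\<close>
  then have "((\<lambda>s. acceleration \<A> c s \<kappa>) has_vector_derivative (g3 t, 2 *\<^sub>R (g1 t \<Delta> g2 t))) (at t)"
    by (rule has_vector_derivative_transform_within_open[OF _ T]) (simp add: acc)
  then have "vector_derivative (\<lambda>s. acceleration \<A> c s \<kappa>) (at t) = (g3 t, 2 *\<^sub>R (g1 t \<Delta> g2 t))"
    by (rule vector_derivative_at)
  moreover have "covariant_along \<A> N c (acceleration \<A> c) t \<kappa> = 0"
    using geo t by (simp add: second_order_geodesic_def)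
  moreover have "velocity \<A> c t \<kappa> = g1 t"
    using \<kappa> t by (simp add: velocity_def g1_def g_def)
  ultimately have eq: "(g3 t, 2 *\<^sub>R (g1 t \<Delta> g2 t)) =
      (R \<kappa> (g t) (g1 t) (g1 t \<Delta> g1 t), - (g1 t \<Delta> g2 t) + C \<kappa> (g t) (g1 t) (g1 t \<Delta> g1 t))"
    using \<kappa> t acc[OF T(2)] RC
    by (simp add: covariant_along_def conn_form_of_def special_form_def g_def zero_prod_def algebra_simps)
  then show "R \<kappa> (g t) (g1 t) (g1 t \<Delta> g1 t) = g3 t" by simp
  have "C \<kappa> (g t) (g1 t) (g1 t \<Delta> g1 t) = 2 *\<^sub>R (g1 t \<Delta> g2 t) + g1 t \<Delta> g2 t"
    using eq by (simp add: algebra_simps)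
  also have "\<dots> = (2 + 1) *\<^sub>R (g1 t \<Delta> g2 t)" by (simp only: scaleR_add_left scaleR_one)
  finally show "C \<kappa> (g t) (g1 t) (g1 t \<Delta> g1 t) = 3 *\<^sub>R (g1 t \<Delta> g2 t)" by simp
qed

section \<open>Comparison with the Hessian structure\<close>

lemma fun_rep_chart:
  assumes "is_chart \<kappa>" "p \<in> fst \<kappa>"
  shows "fun_rep \<kappa> f (snd \<kappa> p) = f p"
  using assms by (auto simp: fun_rep_def is_chart_def homeomorphism_def split_beta)

theorem theorem5p3:
  fixes \<A> :: "('m::t2_space, 'e::banach) chart set"
    and N :: "('m, 'e) connection2"
    and K :: "('m, 'e) hessian3"
    and f :: "'m \<Rightarrow> real" and m :: 'm and v :: "('m, 'e) tvec"
    and J :: "real set" and c :: "real \<Rightarrow> 'm"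
  assumes "finite_dimensional TYPE('e)" and "paracompact TYPE('m)" and "smooth_structure \<A>"
    and "special_second_order_connection \<A> N"
    and "associated_hessian \<A> N K" and "symmetric_hessian \<A> K"
    and "f \<in> smooth_functions \<A>" and "v \<in> tangent_space \<A> m"
    and "second_order_geodesic \<A> N J c" and "0 \<in> J" and "c 0 = m" and "velocity \<A> c 0 = v"
  shows "K f m v v v = (deriv ^^ 3) (f \<circ> c) 0"
proof -
  obtain \<kappa> where \<kappa>: "\<kappa> \<in> \<A>" "m \<in> fst \<kappa>" and chart: "is_chart \<kappa>"
    using assms(3) unfolding smooth_structure_def by (metis UNIV_I UN_E)
  \<comment> \<open>Both the Hessian formula and the covariant derivative along \<open>c\<close>
    refer to this one choice of symbols, so the same \<open>R\<close> and \<open>C\<close> occur in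
    both.\<close>
  obtain R C where RC: "christoffel \<A> N = (R, C)" by (cases "christoffel \<A> N") blast
  define F where "F = fun_rep \<kappa> f"
  define W where "W = snd \<kappa> ` fst \<kappa>"
  define T where "T = {t \<in> J. c t \<in> fst \<kappa>}"
  define g where "g = snd \<kappa> \<circ> c"
  define g1 where "g1 t = vector_derivative g (at t)" for t
  define g2 where "g2 t = vector_derivative g1 (at t)" for t
  define g3 where "g3 t = vector_derivative g2 (at t)" for t
  have curve: "smooth_curve \<A> J c" using assms(9) by (simp add: second_order_geodesic_def)
  have T: "open T" "0 \<in> T" "g ` T \<subseteq> W"
    using open_chart_domain_along[OF curve chart] assms \<kappa> by (auto simp: T_def W_def g_def)
  have W: "open W" using chart by (auto simp: is_chart_def W_def split_beta)
  have F: "smooth_on W F" using assms(7) \<kappa> by (auto simp: smooth_functions_def F_def W_def)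
  have sm: "smooth_on T g" using curve \<kappa> by (auto simp: smooth_curve_def T_def g_def)
  have sm1: "smooth_on T g1" unfolding g1_def by (rule smooth_on_vector_derivative[OF T(1) sm])
  have sm2: "smooth_on T g2" unfolding g2_def by (rule smooth_on_vector_derivative[OF T(1) sm1])
  have "(deriv ^^ 3) (f \<circ> c) 0 = (deriv ^^ 3) (\<lambda>s. F (g s)) 0"
  proof -
    \<comment> \<open>The curve may leave the chart, but higher derivatives at 0 depend only on
      values near 0.\<close>
    have "\<forall>\<^sub>F s in nhds 0. (f \<circ> c) s = F (g s)"
      unfolding eventually_nhds using T
      by (intro exI[of _ T]) (auto simp: T_def F_def g_def fun_rep_chart[OF chart])
    then show ?thesis by (rule higher_deriv_cong_ev) simp
  qed
  also have "\<dots> = D3 F (g 0) (g1 0) (g1 0) (g1 0) + 3 * D2 F (g 0) (g1 0) (g2 0) + D1 F (g 0) (g3 0)"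
    using smooth_on_has_vector_derivative[OF sm] smooth_on_has_vector_derivative[OF sm1]
      smooth_on_has_vector_derivative[OF sm2 T(2)]
    by (intro deriv_cube_compose[OF assms(1) W F T])
      (simp_all flip: g1_def g2_def g3_def)
  also have "\<dots> = K f m v v v"
  proof -
    have u: "g 0 = snd \<kappa> m" "g 0 \<in> W" using assms T by (auto simp: g_def)
    have v: "v \<kappa> = g1 0"
      using assms(11,12) \<kappa> by (auto simp: velocity_def g1_def g_def)
    obtain B :: "'e set" where B: "finite B" "span B = UNIV"
      using assms(1) unfolding finite_dimensional_def by blast
    note L = sym_lin[OF B bilinear_D2[OF W u(2) F] D2_commute[OF W u(2) F]]
    have geo: "R \<kappa> (g 0) (g1 0) (g1 0 \<Delta> g1 0) = g3 0"
      "C \<kappa> (g 0) (g1 0) (g1 0 \<Delta> g1 0) = 3 *\<^sub>R (g1 0 \<Delta> g2 0)"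
      using second_order_geodesic_chart[OF assms(9) \<kappa>(1) chart assms(10) _ RC] \<kappa>(2) assms(11)
      by (simp_all add: g_def g1_def[abs_def] g2_def[abs_def] g3_def)
    have "K f m v v v = D3 F (g 0) (g1 0) (g1 0) (g1 0)
        + sym_lin (D2 F (g 0)) (C \<kappa> (g 0) (g1 0) (g1 0 \<Delta> g1 0))
        + D1 F (g 0) (R \<kappa> (g 0) (g1 0) (g1 0 \<Delta> g1 0))"
      using assms(5,7,8) \<kappa> RC
      by (simp add: associated_hessian_def Let_def v u(1) F_def)
    \<comment> \<open>Linearity of \<open>sym_lin\<close> sends
      \<open>3 *\<^sub>R (g1 0 \<Delta> g2 0)\<close> to the mixed term
      \<open>3 * D2 F (g 0) (g1 0) (g2 0)\<close>.\<close>
    then show ?thesis by (simp add: geo linear_scale[OF L(1)] L(2))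
  qed
  finally show ?thesis by simp
qed

end
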